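(* Let $c>0$ be any real constant and define $$u(t,x)=\begin{cases}-\frac c6e^{ct-x}, & x\ge ct,\\[2pt] -\frac c2e^{x-ct}+\frac c3e^{2x-2ct}, & x<ct.\end{cases}$$ Then $u$ is a weak solution of the equation $u_t-u_{txx}=\partial_x(2+\partial_x)\big[(2-\partial_x)u\big]^2$ with initial datum $u_0(x)=u(0,x)$; that is, for every $T>0$ and every $\varphi\in C^1([0,T];C_0^\infty(\mathbb R))$, $$\int_0^T\!\!\int_{\mathbb R}\Big((\varphi_t-\varphi_{txx})\,u-\big(\partial_x(2-\partial_x)\varphi\big)\big[(2-\partial_x)u\big]^2\Big)dx\,dt=\int_{\mathbb R}\big(u(T)-u_{xx}(T)\big)\varphi(T)\,dx-\int_{\mathbb R}\big(u_0-u_{0xx}\big)\varphi(0)\,dx.$$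
   Context: Here $(2-\partial_x)u=2u-u_x$ and $\partial_x(2-\partial_x)\varphi=2\varphi_x-\varphi_{xx}$. The derivatives $u_x$ and $u_{xx}$ are taken in the sense of distributions in $x$, and $u(T)$, $\varphi(T)$, $\varphi(0)$ denote the functions of $x$ obtained by fixing time. *)

theory Defs
  imports "HOL-Analysis.Analysis"
begin

text \<open>The space of smooth compactly supported real functions on the line.\<close>

definition test_functions :: "(real \<Rightarrow> real) set" where
  "test_functions =
     {f. (\<forall>k x. (deriv ^^ k) f field_differentiable at x) \<and> compact (closure {x. f x \<noteq> 0})}"

text \<open>
  Convergence in that space: the supports eventually lie in one compact set, and all
  derivatives converge uniformly.  For sequences, and more generally along filters with a
  countable base such as \<open>at t within {0..T}\<close>, this is convergence in the usual
  inductive limit topology.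
\<close>

definition test_tendsto :: "('i \<Rightarrow> real \<Rightarrow> real) \<Rightarrow> (real \<Rightarrow> real) \<Rightarrow> 'i filter \<Rightarrow> bool" where
  "test_tendsto f l F \<longleftrightarrow>
     l \<in> test_functions \<and>
     (\<exists>K. compact K \<and> (\<forall>\<^sub>F i in F. f i \<in> test_functions \<and> closure {x. f i x \<noteq> 0} \<subseteq> K)) \<and>
     (\<forall>k. uniform_limit UNIV (\<lambda>i. (deriv ^^ k) (f i)) ((deriv ^^ k) l) F)"

text \<open>
  \<open>C1_test T \<phi> \<phi>t\<close>: the curve \<open>t \<mapsto> \<phi> t\<close> is continuously differentiable from \<open>{0..T}\<close> into
  the space of test functions (one-sidedly at the endpoints), with derivative \<open>\<phi>t\<close>.  Values
  for times outside \<open>{0..T}\<close> are irrelevant.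
\<close>

definition C1_test :: "real \<Rightarrow> (real \<Rightarrow> real \<Rightarrow> real) \<Rightarrow> (real \<Rightarrow> real \<Rightarrow> real) \<Rightarrow> bool" where
  "C1_test T \<phi> \<phi>t \<longleftrightarrow>
     (\<forall>t\<in>{0..T}. \<phi> t \<in> test_functions \<and>
        test_tendsto (\<lambda>s x. (\<phi> s x - \<phi> t x) / (s - t)) (\<phi>t t) (at t within {0..T}) \<and>
        test_tendsto \<phi>t (\<phi>t t) (at t within {0..T}))"

definition locally_integrable :: "(real \<Rightarrow> real) \<Rightarrow> bool" where
  "locally_integrable f \<longleftrightarrow> (\<forall>K. compact K \<longrightarrow> set_integrable lborel K f)"

text \<open>The derivative of \<open>f\<close> in the sense of distributions is (represented by) \<open>g\<close>.\<close>

definition has_weak_deriv :: "(real \<Rightarrow> real) \<Rightarrow> (real \<Rightarrow> real) \<Rightarrow> bool" where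
  "has_weak_deriv f g \<longleftrightarrow>
     locally_integrable f \<and> locally_integrable g \<and>
     (\<forall>\<psi>\<in>test_functions. (LBINT x. f x * deriv \<psi> x) = - (LBINT x. g x * \<psi> x))"

definition has_weak_derivs2 :: "(real \<Rightarrow> real) \<Rightarrow> (real \<Rightarrow> real) \<Rightarrow> (real \<Rightarrow> real) \<Rightarrow> bool" where
  "has_weak_derivs2 f f1 f2 \<longleftrightarrow> has_weak_deriv f f1 \<and> has_weak_deriv f1 f2"

text \<open>
  The integrand of the space-time integral at a fixed time, where \<open>v\<close> and \<open>v1\<close> stand for
  \<open>u\<close> and \<open>u\<^sub>x\<close>, and \<open>p\<close> and \<open>q\<close> for \<open>\<phi>\<close> and \<open>\<phi>\<^sub>t\<close>.
\<close>

definition weak_integrand ::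
    "(real \<Rightarrow> real) \<Rightarrow> (real \<Rightarrow> real) \<Rightarrow> (real \<Rightarrow> real) \<Rightarrow> (real \<Rightarrow> real) \<Rightarrow> real \<Rightarrow> real" where
  "weak_integrand v v1 p q x =
     (q x - deriv (deriv q) x) * v x
     - (2 * deriv p x - deriv (deriv p) x) * (2 * v x - v1 x)\<^sup>2"

text \<open>
  Weak solutions of \<open>u\<^sub>t - u\<^sub>t\<^sub>x\<^sub>x = \<partial>\<^sub>x (2 + \<partial>\<^sub>x) [(2 - \<partial>\<^sub>x) u]\<^sup>2\<close> with initial datum \<open>u0\<close>.
  Distributional derivatives are only determined almost everywhere, so they are required to
  exist and the identity is required for every choice of representatives.  The integrability
  requirements are explicit because the Bochner integral of a non-integrable function is 0.
\<close>

definition weak_solution :: "(real \<Rightarrow> real \<Rightarrow> real) \<Rightarrow> (real \<Rightarrow> real) \<Rightarrow> bool" where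
  "weak_solution u u0 \<longleftrightarrow>
     (\<forall>t\<ge>0. \<exists>v1 v2. has_weak_derivs2 (u t) v1 v2) \<and>
     (\<exists>v1 v2. has_weak_derivs2 u0 v1 v2) \<and>
     (\<forall>ux uxx u0x u0xx.
        (\<forall>t\<ge>0. has_weak_derivs2 (u t) (ux t) (uxx t)) \<and> has_weak_derivs2 u0 u0x u0xx \<longrightarrow>
        (\<forall>T>0. \<forall>\<phi> \<phi>t. C1_test T \<phi> \<phi>t \<longrightarrow>
           (\<forall>t\<in>{0..T}. integrable lborel (weak_integrand (u t) (ux t) (\<phi> t) (\<phi>t t))) \<and>
           set_integrable lborel {0..T}
             (\<lambda>t. LBINT x. weak_integrand (u t) (ux t) (\<phi> t) (\<phi>t t) x) \<and>
           integrable lborel (\<lambda>x. (u T x - uxx T x) * \<phi> T x) \<and>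
           integrable lborel (\<lambda>x. (u0 x - u0xx x) * \<phi> 0 x) \<and>
           (LBINT t:{0..T}. (LBINT x. weak_integrand (u t) (ux t) (\<phi> t) (\<phi>t t) x)) =
             (LBINT x. (u T x - uxx T x) * \<phi> T x) - (LBINT x. (u0 x - u0xx x) * \<phi> 0 x)))"

definition travelling_wave :: "real \<Rightarrow> real \<Rightarrow> real \<Rightarrow> real" where
  "travelling_wave c t x =
     (if x \<ge> c * t then - (c / 6) * exp (c * t - x)
      else - (c / 2) * exp (x - c * t) + c / 3 * exp (2 * x - 2 * c * t))"

end

theory Submission
  imports Defs
begin

text \<open>
  Away from \<open>x = c t\<close> the wave satisfies \<open>u - u\<^sub>x\<^sub>x = m(x - c t)\<close> with \<open>m(y) = - c exp(2 y)\<close> for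
  \<open>y < 0\<close> and \<open>m(y) = 0\<close> for \<open>y > 0\<close>, while \<open>w = (2 u - u\<^sub>x)\<^sup>2 = (c\<^sup>2/4) exp(- 2 \<bar>x - c t\<bar>)\<close> satisfies
  \<open>2 w + w\<^sub>x = - c m(x - c t)\<close>. Since \<open>u\<close>, \<open>u\<^sub>x\<close> and \<open>w\<close> are continuous, integrating by parts in \<open>x\<close>
  gives no contribution at the crest, so the inner integral equals
  \<open>\<integral> m(x - c t) (\<phi>\<^sub>t + c \<phi>\<^sub>x) dx\<close>. This is the time derivative of
  \<open>\<integral> m(y) \<phi>(t, y + c t) dy\<close>, and the identity is the fundamental theorem of calculus in \<open>t\<close>.
  As \<open>u\<^sub>x\<close> enters nonlinearly, its weak representatives have to be identified almost everywhere,
  by the fundamental lemma of the calculus of variations.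
\<close>

subsection \<open>Smooth functions\<close>

definition smooth :: "(real \<Rightarrow> real) \<Rightarrow> bool" where
  "smooth f \<longleftrightarrow> (\<forall>k x. (deriv ^^ k) f field_differentiable at x)"

lemma smooth_iff: "smooth f \<longleftrightarrow> (\<forall>x. f field_differentiable at x) \<and> smooth (deriv f)"
proof
  assume f: "smooth f"
  have "(deriv ^^ k) (deriv f) field_differentiable at x" for k x
    using f[unfolded smooth_def, rule_format, of "Suc k" x] by (simp add: funpow_Suc_right del: funpow.simps)
  moreover have "f field_differentiable at x" for x
    using f[unfolded smooth_def, rule_format, of 0 x] by simp
  ultimately show "(\<forall>x. f field_differentiable at x) \<and> smooth (deriv f)"
    by (simp add: smooth_def)
next
  assume f: "(\<forall>x. f field_differentiable at x) \<and> smooth (deriv f)"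
  have "(deriv ^^ k) f field_differentiable at x" for k x
    using f by (cases k) (auto simp: smooth_def funpow_Suc_right simp del: funpow.simps(2))
  then show "smooth f" by (simp add: smooth_def)
qed

lemma smooth_deriv: "smooth f \<Longrightarrow> smooth (deriv f)"
  using smooth_iff by blast

lemma smooth_DERIV: "smooth f \<Longrightarrow> (f has_real_derivative deriv f x) (at x)"
  using smooth_iff DERIV_deriv_iff_field_differentiable by blast

text \<open>Any class of functions closed under differentiation consists of smooth functions. This
  turns each smoothness proof into the choice of such a class, with no formula for the higher
  derivatives.\<close>

lemma smooth_coinduct:
  assumes "f \<in> S"
    and step: "\<And>g. g \<in> S \<Longrightarrow> \<exists>g'\<in>S. \<forall>x. (g has_real_derivative g' x) (at x)"
  shows "smooth f"
proof -
  have *: "g \<in> S \<Longrightarrow> (deriv ^^ k) g \<in> S" for g k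
  proof (induction k arbitrary: g)
    case (Suc k)
    obtain g' where "g' \<in> S" "\<forall>x. (g has_real_derivative g' x) (at x)"
      using step[OF Suc.prems] by blast
    moreover from this have "deriv g = g'" by (auto intro: DERIV_imp_deriv)
    ultimately show ?case
      using Suc.IH[of g'] by (simp add: funpow_Suc_right del: funpow.simps(2))
  qed simp
  show ?thesis
    unfolding smooth_def
  proof (intro allI)
    fix k x
    show "(deriv ^^ k) f field_differentiable at x"
      using step[OF *[OF \<open>f \<in> S\<close>, of k]] by (auto simp: field_differentiable_def)
  qed
qed

lemma smooth_mult:
  assumes "smooth f" "smooth g"
  shows "smooth (\<lambda>x. f x * g x)"
proof -
  \<comment> \<open>finite sums of products of smooth functions are closed under differentiation\<close>
  define S where "S = {h. \<exists>L. (\<forall>(f, g)\<in>set L. smooth f \<and> smooth g) \<and>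
                          h = (\<lambda>x::real. \<Sum>(f, g)\<leftarrow>L. f x * g x)}"
  show ?thesis
  proof (rule smooth_coinduct[where S = S])
    show "(\<lambda>x. f x * g x) \<in> S"
      unfolding S_def using assms by (intro CollectI exI[of _ "[(f, g)]"]) auto
  next
    fix h assume "h \<in> S"
    then obtain L where L: "\<forall>(f, g)\<in>set L. smooth f \<and> smooth g"
      and h: "h = (\<lambda>x. \<Sum>(f, g)\<leftarrow>L. f x * g x)" by (auto simp: S_def)
    define D where "D L = concat (map (\<lambda>(f, g). [(deriv f, g), (f, deriv g)]) L)"
      for L :: "((real \<Rightarrow> real) \<times> (real \<Rightarrow> real)) list"
    have "((\<lambda>x. \<Sum>(f, g)\<leftarrow>L. f x * g x) has_real_derivative (\<Sum>(f, g)\<leftarrow>D L. f x * g x)) (at x)" for x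
      using L
      by (induction L)
         (auto simp: D_def algebra_simps intro!: derivative_eq_intros dest: smooth_DERIV)
    moreover have "\<forall>(f, g)\<in>set (D L). smooth f \<and> smooth g"
      using L by (auto simp: D_def smooth_deriv)
    ultimately show "\<exists>g'\<in>S. \<forall>x. (h has_real_derivative g' x) (at x)"
      unfolding S_def h by (intro bexI[of _ "\<lambda>x. \<Sum>(f, g)\<leftarrow>D L. f x * g x"]) blast+
  qed
qed

lemma smooth_affine:
  assumes "smooth f"
  shows "smooth (\<lambda>x. f (a * x + b))"
\<comment> \<open>The scalar \<open>r\<close> absorbs the factor \<open>a\<close> that the chain
  rule produces, which closes the class.\<close>
proof (rule smooth_coinduct[where S = "{\<lambda>x. r * f (a * x + b) | r f. smooth f}"])
  show "(\<lambda>x. f (a * x + b)) \<in> {\<lambda>x. r * f (a * x + b) | r f. smooth f}"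
    using assms by (intro CollectI exI[of _ 1] exI[of _ f]) auto
next
  fix g assume "g \<in> {\<lambda>x. r * f (a * x + b) | r f. smooth f}"
  then obtain r f where f: "smooth f" and g: "g = (\<lambda>x. r * f (a * x + b))" by auto
  have "(g has_real_derivative (r * a) * deriv f (a * x + b)) (at x)" for x
    unfolding g by (rule derivative_eq_intros DERIV_chain2[OF smooth_DERIV[OF f]] refl | simp)+
  then show "\<exists>g'\<in>{\<lambda>x. r * f (a * x + b) | r f. smooth f}. \<forall>x. (g has_real_derivative g' x) (at x)"
    using smooth_deriv[OF f] by (intro bexI[of _ "\<lambda>x. (r * a) * deriv f (a * x + b)"]) blast+
qed

section \<open>A smooth function vanishing exactly on a half-line\<close>

definition flat :: "real \<Rightarrow> real" where
  "flat x = (if x > 0 then exp (- 1 / x) else 0)"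

lemma poly_exp_minus_tendsto_0: "((\<lambda>y::real. poly P y * exp (- y)) \<longlongrightarrow> 0) at_top"
proof -
  have "((\<lambda>y. \<Sum>i\<le>degree P. coeff P i * (y ^ i / exp y)) \<longlongrightarrow> (\<Sum>i\<le>degree P. coeff P i * 0)) at_top"
    by (intro tendsto_intros tendsto_power_div_exp_0)
  then show ?thesis
    by (simp add: poly_altdef exp_minus sum_distrib_right divide_inverse mult.assoc)
qed

text \<open>Functions equal to \<open>P(1/x) exp(-1/x)\<close> for \<open>x > 0\<close> and to
  \<open>0\<close> elsewhere form a class closed under differentiation: the new polynomial is
  \<open>y^2 (P - P')\<close> in \<open>y = 1/x\<close>. At the origin, exponential decay beats
  every polynomial in \<open>1/x\<close>.\<close>

lemma smooth_flat: "smooth flat"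
proof -
  define F where "F P x = (if x > 0 then poly P (1 / x) * exp (- 1 / x) else 0)" for P and x :: real
  have deriv_F: "(F P has_real_derivative F ([:0, 0, 1:] * (P - pderiv P)) x) (at x)" for P x
  proof -
    consider "x > 0" | "x < 0" | "x = 0" by linarith
    then show ?thesis
    proof cases
      case 1
      have "((\<lambda>x. poly P (1 / x) * exp (- 1 / x)) has_real_derivative
              F ([:0, 0, 1:] * (P - pderiv P)) x) (at x)"
        using 1
        by (auto intro!: derivative_eq_intros DERIV_chain2[OF poly_DERIV] simp: F_def field_simps power2_eq_square)
      then show ?thesis
        by (rule DERIV_cong_ev[THEN iffD1, rotated 3])
           (auto simp: F_def 1 intro: eventually_mono[OF eventually_nhds_in_open[of "{0<..}"]])
    next
      case 2
      have "((\<lambda>x. 0) has_real_derivative 0) (at x)" by simp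
      then have "(F P has_real_derivative 0) (at x)"
        by (rule DERIV_cong_ev[THEN iffD1, rotated 3])
           (use 2 in \<open>auto simp: F_def intro!: eventually_mono[OF eventually_nhds_in_open[of "{..<0}"]]\<close>)
      then show ?thesis using 2 by (simp add: F_def)
    next
      case 3
      have "((\<lambda>h. F P h / h) \<longlongrightarrow> 0) (at_right 0)"
      proof -
        \<comment> \<open>The factor \<open>[:0, 1:]\<close> is the \<open>1/h\<close> of the
          difference quotient, read as a polynomial in \<open>inverse h\<close>.\<close>
        have "((\<lambda>h. poly ([:0, 1:] * P) (inverse h) * exp (- inverse h)) \<longlongrightarrow> 0) (at_right 0)"
          by (rule filterlim_compose[OF poly_exp_minus_tendsto_0 filterlim_inverse_at_top_right])
        then show ?thesis
          by (rule Lim_transform_eventually)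
             (auto simp: eventually_at_right_field F_def divide_inverse intro!: exI[of _ 1])
      qed
      moreover have "((\<lambda>h. F P h / h) \<longlongrightarrow> 0) (at_left 0)"
        by (rule Lim_transform_eventually[of "\<lambda>_. 0"])
           (auto simp: eventually_at_left_field F_def intro!: exI[of _ "-1"])
      ultimately have "((\<lambda>h. F P h / h) \<longlongrightarrow> 0) (at 0)"
        by (simp add: filterlim_split_at)
      then show ?thesis using 3 by (simp add: DERIV_def F_def)
    qed
  qed
  have "smooth (F 1)"
    by (rule smooth_coinduct[where S = "range F"]) (use deriv_F in \<open>auto\<close>)
  moreover have "F 1 = flat" by (auto simp: F_def flat_def)
  ultimately show ?thesis by simp
qed

subsection \<open>Test functions\<close>

lemma test_functions_iff: "f \<in> test_functions \<longleftrightarrow> smooth f \<and> compact (closure {x. f x \<noteq> 0})"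
  by (simp add: test_functions_def smooth_def)

lemma test_function_DERIV: "f \<in> test_functions \<Longrightarrow> (f has_real_derivative deriv f x) (at x)"
  by (simp add: test_functions_iff smooth_DERIV)

lemma test_function_continuous: "f \<in> test_functions \<Longrightarrow> continuous_on A f"
  by (meson DERIV_isCont continuous_at_imp_continuous_on test_function_DERIV)

lemma test_function_measurable: "f \<in> test_functions \<Longrightarrow> f \<in> borel_measurable borel"
  by (simp add: borel_measurable_continuous_onI test_function_continuous)

lemma test_function_zero_outside_Icc:
  assumes "f \<in> test_functions"
  obtains a b where "a < b" "\<And>x. x \<notin> {a..b} \<Longrightarrow> f x = 0"
proof -
  have "bounded (closure {x. f x \<noteq> 0})"
    using assms by (auto simp: test_functions_iff compact_imp_bounded)
  then obtain B where B: "\<And>x. x \<in> closure {x. f x \<noteq> 0} \<Longrightarrow> \<bar>x\<bar> \<le> B"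
    by (auto simp: bounded_iff)
  have "f x = 0" if "x \<notin> {- \<bar>B\<bar> - 1..\<bar>B\<bar> + 1}" for x
    using B[of x] closure_subset[of "{x. f x \<noteq> 0}"] that by force
  then show thesis by (intro that[of "- \<bar>B\<bar> - 1" "\<bar>B\<bar> + 1"]) auto
qed

lemma test_functionI:
  assumes "smooth f" "\<And>x. x \<notin> {a..b} \<Longrightarrow> f x = 0"
  shows "f \<in> test_functions"
proof -
  have "closure {x. f x \<noteq> 0} \<subseteq> {a..b}"
    using assms(2) by (intro closure_minimal) (blast, simp)
  then have "compact (closure {x. f x \<noteq> 0})"
    using compact_Icc closed_closure by (metis bounded_subset compact_eq_bounded_closed)
  with assms(1) show ?thesis by (simp add: test_functions_iff)
qed

lemma deriv_zero_outside_Icc: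
  fixes f :: "real \<Rightarrow> real"
  assumes "\<And>x. x \<notin> {a..b} \<Longrightarrow> f x = 0" "x \<notin> {a..b}"
  shows "deriv f x = 0"
proof -
  have "((\<lambda>x. 0) has_real_derivative 0) (at x)" by simp
  then have "(f has_real_derivative 0) (at x)"
    by (rule DERIV_cong_ev[THEN iffD1, rotated 3])
       (use assms in \<open>auto intro!: eventually_mono[OF eventually_nhds_in_open[of "- {a..b}"]]\<close>)
  then show ?thesis by (rule DERIV_imp_deriv)
qed

lemma deriv_test_function:
  assumes "f \<in> test_functions"
  shows "deriv f \<in> test_functions"
proof -
  obtain a b where ab: "\<And>x. x \<notin> {a..b} \<Longrightarrow> f x = 0"
    using test_function_zero_outside_Icc[OF assms] by metis
  show ?thesis
  proof (rule test_functionI[of _ a b])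
    show "smooth (deriv f)" using assms by (simp add: test_functions_iff smooth_deriv)
    show "deriv f x = 0" if "x \<notin> {a..b}" for x
      using ab that by (rule deriv_zero_outside_Icc)
  qed
qed

lemma test_function_bounded:
  assumes "f \<in> test_functions"
  obtains B where "B > 0" "\<And>x. \<bar>f x\<bar> \<le> B"
proof -
  obtain a b where ab: "\<And>x. x \<notin> {a..b} \<Longrightarrow> f x = 0"
    using test_function_zero_outside_Icc[OF assms] by metis
  have "bounded (f ` {a..b})"
    by (intro compact_imp_bounded compact_continuous_image test_function_continuous assms compact_Icc)
  then obtain B where B: "\<And>x. x \<in> {a..b} \<Longrightarrow> \<bar>f x\<bar> \<le> B" unfolding bounded_iff by (metis imageI real_norm_def)
  show thesis
  proof (rule that[of "\<bar>B\<bar> + 1"])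
    show "\<bar>f x\<bar> \<le> \<bar>B\<bar> + 1" for x using B[of x] ab[of x] by (cases "x \<in> {a..b}") auto
  qed auto
qed

text \<open>The truncations to \<open>[-n, n]\<close> are integrable, hence measurable, and converge
  pointwise.\<close>

lemma locally_integrable_borel:
  assumes "locally_integrable f"
  shows "f \<in> borel_measurable borel"
proof (rule borel_measurable_LIMSEQ_real)
  show "(\<lambda>x. indicator {- real n..real n} x * f x) \<in> borel_measurable borel" for n
    using assms by (force simp: locally_integrable_def set_integrable_def dest: borel_measurable_integrable)
  fix x
  have "\<forall>\<^sub>F n in sequentially. indicator {- real n..real n} x * f x = f x"
    using eventually_ge_at_top[of "nat \<lceil>\<bar>x\<bar>\<rceil>"] by eventually_elim (simp add: indicator_def, linarith)
  then show "(\<lambda>n. indicator {- real n..real n} x * f x) \<longlonglongrightarrow> f x"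
    by (rule tendsto_eventually)
qed

lemma integrable_mult_test:
  assumes "locally_integrable f" "\<psi> \<in> test_functions"
  shows "integrable lborel (\<lambda>x. f x * \<psi> x)"
proof -
  obtain a b where ab: "\<And>x. x \<notin> {a..b} \<Longrightarrow> \<psi> x = 0"
    using test_function_zero_outside_Icc[OF assms(2)] by metis
  obtain B where B: "B > 0" "\<And>x. \<bar>\<psi> x\<bar> \<le> B"
    using test_function_bounded[OF assms(2)] by metis
  have "integrable lborel (\<lambda>x. indicator {a..b} x * f x)"
    using assms(1) compact_Icc[of a b] by (force simp: locally_integrable_def set_integrable_def)
  then have "integrable lborel (\<lambda>x. B * (indicator {a..b} x * f x))" by simp
  then show ?thesis
  proof (rule Bochner_Integration.integrable_bound)
    show "(\<lambda>x. f x * \<psi> x) \<in> borel_measurable lborel"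
      using locally_integrable_borel[OF assms(1)] test_function_measurable[OF assms(2)] by simp
    have "norm (f x * \<psi> x) \<le> norm (B * (indicator {a..b} x * f x))" for x
      using B(2)[of x] \<open>B > 0\<close> ab[of x]
      by (cases "x \<in> {a..b}") (auto simp: abs_mult mult.commute[of B] intro!: mult_left_mono)
    then show "AE x in lborel. norm (f x * \<psi> x) \<le> norm (B * (indicator {a..b} x * f x))" by simp
  qed
qed

subsection \<open>Uniqueness of weak derivatives\<close>

text \<open>Open intervals are an intersection-stable generator of the Borel sets, and the sets over
  which \<open>f\<close> integrates to zero form a Dynkin system; \<open>zero\<close> supplies its
  closure under complements. So \<open>f\<close> and \<open>0\<close> have equal integrals over all
  Borel sets.\<close>

lemma AE_zero_if_interval_integrals_zero:
  fixes f :: "real \<Rightarrow> real"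
  assumes f: "integrable lborel f" and zero: "(LBINT x. f x) = 0"
    and int: "\<And>a b. a < b \<Longrightarrow> (LBINT x:{a<..<b}. f x) = 0"
  shows "AE x in lborel. f x = 0"
proof (rule density_unique_real[OF f integrable_zero])
  have si: "set_integrable lborel A f" if "A \<in> sets borel" for A
    using f that unfolding set_integrable_def by (intro integrable_mult_indicator) auto
  fix A :: "real set" assume "A \<in> sets lborel"
  let ?G = "range (\<lambda>(a, b). {a<..<b :: real})"
  have borel: "sets borel = sigma_sets UNIV ?G"
    by (subst borel_eq_box) (simp add: box_real[abs_def])
  have "Int_stable ?G"
  proof (rule Int_stableI)
    fix A B assume "A \<in> ?G" "B \<in> ?G"
    then obtain a b c d where "A = {a<..<b}" "B = {c<..<d}" by auto
    then have "A \<inter> B = {max a c<..<min b d}" by auto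
    then show "A \<inter> B \<in> ?G" by blast
  qed
  moreover have "?G \<subseteq> Pow UNIV" by simp
  moreover have "A \<in> sigma_sets UNIV ?G" using \<open>A \<in> sets lborel\<close> borel by simp
  ultimately have "(LBINT x:A. f x) = 0"
  proof (induction rule: sigma_sets_induct_disjoint)
    case (basic A)
    then obtain a b where "A = {a<..<b}" by auto
    then show ?case using int[of a b] by (cases "a < b") (auto simp: set_lebesgue_integral_def)
  next
    case empty
    then show ?case by (simp add: set_lebesgue_integral_def)
  next
    case (compl A)
    then have A: "A \<in> sets borel" unfolding borel by blast
    have "(LBINT x:A \<union> (UNIV - A). f x) = (LBINT x:A. f x) + (LBINT x:UNIV - A. f x)"
      by (rule set_integral_Un[OF _ si si]) (use A in auto)
    moreover have "(LBINT x:A \<union> (UNIV - A). f x) = 0"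
      using zero by (simp add: set_lebesgue_integral_def)
    ultimately show ?case using compl by simp
  next
    case (union A)
    have A: "A i \<in> sets borel" for i using union(2) unfolding borel by blast
    then have U: "(\<Union>i. A i) \<in> sets borel" by auto
    have "(LBINT x:(\<Union>i. A i). f x) = (\<Sum>i. (LBINT x:A i. f x))"
      by (rule lebesgue_integral_countable_add)
         (use A U si[OF U] union(1) in \<open>auto simp: disjoint_family_on_def\<close>)
    then show ?case by (simp add: union(3))
  qed
  then show "(LBINT x:A. f x) = (LBINT x:A. 0)" by simp
qed

text \<open>These products are smooth bumps supported in \<open>[a, b]\<close>. At an interior point
  both factors tend to \<open>exp 0 = 1\<close>; at any other point one factor is zero for every
  \<open>n\<close>. The arguments have the shape \<open>a * x + b\<close> of
  \<open>smooth_affine\<close>, and \<open>Suc n\<close> keeps the scaling positive.\<close>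

lemma flat_cutoff_tendsto_indicator:
  "(\<lambda>n. flat (real (Suc n) * x + - real (Suc n) * a) * flat (- real (Suc n) * x + real (Suc n) * b))
     \<longlonglongrightarrow> indicator {a<..<b} x"
proof (cases "x \<in> {a<..<b}")
  case True
  have lim: "(\<lambda>n. exp (- 1 / (real (Suc n) * d))) \<longlonglongrightarrow> 1" if "d > 0" for d
  proof -
    have "(\<lambda>n. exp (inverse (real (Suc n)) * (- 1 / d))) \<longlonglongrightarrow> exp (0 * (- 1 / d))"
      by (intro tendsto_intros LIMSEQ_inverse_real_of_nat)
    then show ?thesis by (simp add: field_simps del: of_nat_Suc)
  qed
  have "flat (real (Suc n) * x + - real (Suc n) * a) = exp (- 1 / (real (Suc n) * (x - a)))"
    "flat (- real (Suc n) * x + real (Suc n) * b) = exp (- 1 / (real (Suc n) * (b - x)))" for n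
    using True by (simp_all add: flat_def algebra_simps del: of_nat_Suc)
  then show ?thesis
    using tendsto_mult[OF lim[of "x - a"] lim[of "b - x"]] True by simp
next
  case False
  have "flat (real (Suc n) * x + - real (Suc n) * a) * flat (- real (Suc n) * x + real (Suc n) * b) = 0" for n
  proof -
    have "real (Suc n) * (x - a) \<le> 0 \<or> real (Suc n) * (b - x) \<le> 0"
      using False by (auto simp: mult_le_0_iff)
    then show ?thesis by (auto simp: flat_def algebra_simps simp del: of_nat_Suc)
  qed
  then have "(\<lambda>n. flat (real (Suc n) * x + - real (Suc n) * a) * flat (- real (Suc n) * x + real (Suc n) * b)) = (\<lambda>_. 0)"
    by (rule ext)
  then show ?thesis using False by (simp only: indicator_simps) simp
qed

lemma abs_flat_le_1: "\<bar>flat x\<bar> \<le> 1"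
  by (simp add: flat_def)

text \<open>Testing against the smooth bumps and passing to the limit shows that \<open>g\<close>
  integrates to zero over every bounded open interval. This determines \<open>g\<close> almost
  everywhere on each \<open>(-n, n)\<close>, hence on the line.\<close>

lemma fundamental_lemma_variations:
  assumes g: "locally_integrable g"
    and zero: "\<And>\<psi>. \<psi> \<in> test_functions \<Longrightarrow> (LBINT x. g x * \<psi> x) = 0"
  shows "AE x in lborel. g x = 0"
proof -
  have borel[measurable]: "g \<in> borel_measurable borel" by (rule locally_integrable_borel[OF g])
  have intg: "integrable lborel (\<lambda>x. indicator {a..b} x * g x)" for a b
    using g compact_Icc[of a b] by (force simp: locally_integrable_def set_integrable_def)
  have int: "(LBINT x:{a<..<b}. g x) = 0" for a b
  proof -
    define \<psi> where "\<psi> n x = flat (real (Suc n) * x + - real (Suc n) * a) * flat (- real (Suc n) * x + real (Suc n) * b)"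
      for n x
    have sm: "smooth (\<psi> n)" for n
      unfolding \<psi>_def by (intro smooth_mult smooth_affine smooth_flat)
    have supp: "\<psi> n x = 0" if "x \<notin> {a..b}" for n x
    proof -
      have "real (Suc n) * (x - a) \<le> 0 \<or> real (Suc n) * (b - x) \<le> 0"
        using that by (auto simp: mult_le_0_iff)
      then show ?thesis by (auto simp: \<psi>_def flat_def algebra_simps simp del: of_nat_Suc)
    qed
    have test: "\<psi> n \<in> test_functions" for n by (rule test_functionI[OF sm supp])
    \<comment> \<open>All bumps are bounded by 1 and supported in \<open>[a, b]\<close>, so the
      restriction of \<bar>g\<bar> to this interval dominates.\<close>
    have "(\<lambda>n. LBINT x. g x * \<psi> n x) \<longlonglongrightarrow> (LBINT x. g x * indicator {a<..<b} x)"
    proof (rule integral_dominated_convergence[where w = "\<lambda>x. norm (indicator {a..b} x * g x)"])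
      show "integrable lborel (\<lambda>x. norm (indicator {a..b} x * g x))" by (intro integrable_norm intg)
      show "(\<lambda>x. g x * \<psi> n x) \<in> borel_measurable lborel" for n
        using test_function_measurable[OF test[of n]] by simp
      show "AE x in lborel. (\<lambda>n. g x * \<psi> n x) \<longlonglongrightarrow> g x * indicator {a<..<b} x"
        unfolding \<psi>_def by (intro AE_I2 tendsto_intros flat_cutoff_tendsto_indicator)
      have "norm (g x * \<psi> n x) \<le> norm (indicator {a..b} x * g x)" for n x
      proof (cases "x \<in> {a..b}")
        case True
        have "\<bar>\<psi> n x\<bar> \<le> 1" unfolding \<psi>_def abs_mult by (intro mult_le_one abs_flat_le_1) auto
        then show ?thesis using True by (simp add: abs_mult mult_left_le)
      qed (use supp in simp)
      then show "AE x in lborel. norm (g x * \<psi> n x) \<le> norm (indicator {a..b} x * g x)" for n by simp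
    qed auto
    moreover have "(LBINT x. g x * \<psi> n x) = 0" for n by (rule zero[OF test])
    ultimately have "(LBINT x. g x * indicator {a<..<b} x) = 0"
      by (simp add: LIMSEQ_const_iff)
    then show ?thesis by (simp add: set_lebesgue_integral_def mult.commute)
  qed
  \<comment> \<open>\<open>g\<close> is only locally integrable, so the criterion is applied to its
    truncations.\<close>
  have "AE x in lborel. indicator {- real n<..<real n} x * g x = 0" for n
  proof (rule AE_zero_if_interval_integrals_zero)
    have "integrable lborel (\<lambda>x. indicator {- real n<..<real n} x *\<^sub>R (indicator {- real n..real n} x * g x))"
      by (intro integrable_mult_indicator intg) simp
    then show "integrable lborel (\<lambda>x. indicator {- real n<..<real n} x * g x)"
      by (rule Bochner_Integration.integrable_cong[THEN iffD1, OF refl, rotated]) (simp add: indicator_def)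
    show "(LBINT x. indicator {- real n<..<real n} x * g x) = 0"
      using int[of "- real n" "real n"] by (simp add: set_lebesgue_integral_def)
    fix a b :: real
    \<comment> \<open>Truncation only shortens the interval, possibly to the empty set, which
      \<open>int\<close> also covers.\<close>
    have "(LBINT x:{a<..<b}. indicator {- real n<..<real n} x * g x)
        = (LBINT x:{max a (- real n)<..<min b (real n)}. g x)"
      unfolding set_lebesgue_integral_def
      by (intro Bochner_Integration.integral_cong) (auto simp: indicator_def)
    then show "(LBINT x:{a<..<b}. indicator {- real n<..<real n} x * g x) = 0" by (simp add: int)
  qed
  then have "AE x in lborel. \<forall>n. indicator {- real n<..<real n} x * g x = 0"
    unfolding AE_all_countable by blast
  then show ?thesis
  proof eventually_elim
    case (elim x)
    obtain n where "\<bar>x\<bar> < real n" using reals_Archimedean2 by blast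
    then show ?case using elim[rule_format, of n] by (simp add: indicator_def split: if_splits)
  qed
qed

text \<open>The difference of two representatives annihilates all test functions. This allows an
  arbitrary representative of the first derivative to be replaced inside a square.\<close>

lemma has_weak_deriv_unique:
  assumes "has_weak_deriv f g" "has_weak_deriv f h"
  shows "AE x in lborel. g x = h x"
proof -
  have g: "locally_integrable g" and h: "locally_integrable h"
    using assms by (auto simp: has_weak_deriv_def)
  have "AE x in lborel. g x - h x = 0"
  proof (rule fundamental_lemma_variations)
    show "locally_integrable (\<lambda>x. g x - h x)"
      using g h by (auto simp: locally_integrable_def intro!: set_integral_diff)
    fix \<psi> assume \<psi>: "\<psi> \<in> test_functions"
    have "(LBINT x. g x * \<psi> x) = (LBINT x. h x * \<psi> x)"
      using assms \<psi> by (auto simp: has_weak_deriv_def)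
    then show "(LBINT x. (g x - h x) * \<psi> x) = 0"
      using integrable_mult_test[OF g \<psi>] integrable_mult_test[OF h \<psi>] by (simp add: left_diff_distrib)
  qed
  then show ?thesis by simp
qed

subsection \<open>Weak derivatives of glued functions\<close>

lemma locally_integrable_continuous:
  assumes "continuous_on UNIV f"
  shows "locally_integrable f"
  using assms unfolding locally_integrable_def set_integrable_def
  by (intro allI impI borel_integrable_compact) (auto intro: continuous_on_subset)

text \<open>The product of \<open>f\<close> with a test function is continuous and is differentiable
  off \<open>S\<close>, so the fundamental theorem of calculus with finitely many exceptional points
  applies. Continuity of \<open>f\<close> excludes jump terms at \<open>S\<close>.\<close>

lemma has_weak_deriv_piecewise:
  assumes f: "continuous_on UNIV f" and "finite S"
    and DERIV: "\<And>x. x \<notin> S \<Longrightarrow> (f has_real_derivative g x) (at x)"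
    and g: "locally_integrable g"
  shows "has_weak_deriv f g"
  unfolding has_weak_deriv_def
proof (intro conjI ballI g)
  show lf: "locally_integrable f" by (rule locally_integrable_continuous[OF f])
  fix \<psi> assume \<psi>: "\<psi> \<in> test_functions"
  obtain a b where ab: "a < b" "\<And>x. x \<notin> {a..b} \<Longrightarrow> \<psi> x = 0"
    using test_function_zero_outside_Icc[OF \<psi>] by metis
  define h where "h x = g x * \<psi> x + f x * deriv \<psi> x" for x
  have int: "integrable lborel (\<lambda>x. g x * \<psi> x)" "integrable lborel (\<lambda>x. f x * deriv \<psi> x)"
    by (rule integrable_mult_test[OF g \<psi>], rule integrable_mult_test[OF lf deriv_test_function[OF \<psi>]])
  have h0: "h x = 0" if "x \<notin> {a - 1..b + 1}" for x
  proof -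
    have x: "x \<notin> {a..b}" using that by auto
    show ?thesis
      using ab(2)[OF x] deriv_zero_outside_Icc[of a b \<psi>, OF ab(2) x] by (simp add: h_def)
  qed
  \<comment> \<open>The interval is enlarged by 1 on both sides because \<psi> is known to vanish
    only strictly outside \<open>[a, b]\<close>; the boundary terms are then zero.\<close>
  have "(h has_integral (f (b + 1) * \<psi> (b + 1) - f (a - 1) * \<psi> (a - 1))) {a - 1..b + 1}"
  proof (rule fundamental_theorem_of_calculus_strong[OF \<open>finite S\<close>])
    show "((\<lambda>x. f x * \<psi> x) has_vector_derivative h x) (at x)" if "x \<in> {a - 1..b + 1} - S" for x
      unfolding has_real_derivative_iff_has_vector_derivative[symmetric] h_def
      using that by (auto intro!: derivative_eq_intros DERIV test_function_DERIV[OF \<psi>])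
    show "continuous_on {a - 1..b + 1} (\<lambda>x. f x * \<psi> x)"
      by (intro continuous_on_mult continuous_on_subset[OF f] test_function_continuous[OF \<psi>] subset_UNIV)
  qed (use ab in simp)
  then have "integral {a - 1..b + 1} h = 0"
    using ab(2)[of "b + 1"] ab(2)[of "a - 1"] by (simp add: integral_unique)
  moreover have "set_integrable lborel {a - 1..b + 1} h"
    using int unfolding set_integrable_def h_def by (intro integrable_mult_indicator) auto
  ultimately have "(LBINT x:{a - 1..b + 1}. h x) = 0"
    by (simp add: set_borel_integral_eq_integral)
  moreover have "(LBINT x:{a - 1..b + 1}. h x) = (LBINT x. h x)"
    unfolding set_lebesgue_integral_def
    using h0 by (intro Bochner_Integration.integral_cong) (auto simp: indicator_def)
  ultimately show "(LBINT x. f x * deriv \<psi> x) = - (LBINT x. g x * \<psi> x)"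
    using int by (simp add: h_def)
qed

text \<open>Only the values of the two branches have to match at \<open>s\<close>; the derivatives
  may jump there, since a jump is still locally integrable.\<close>

lemma has_weak_deriv_glue:
  assumes f: "\<And>x. (f has_real_derivative f' x) (at x)" and g: "\<And>x. (g has_real_derivative g' x) (at x)"
    and cont: "continuous_on UNIV f'" "continuous_on UNIV g'" and eq: "f s = g s"
  shows "has_weak_deriv (\<lambda>x. if x \<ge> s then f x else g x) (\<lambda>x. if x \<ge> s then f' x else g' x)"
proof (rule has_weak_deriv_piecewise[where S = "{s}"])
  have cf: "continuous_on A f" "continuous_on A g" for A
    using f g by (meson DERIV_isCont continuous_at_imp_continuous_on)+
  \<comment> \<open>The gluing rule expects the variable on the smaller side of the inequality,
    hence the negation.\<close>
  have "continuous_on UNIV (\<lambda>x. if - x \<le> - s then f x else g x)"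
    by (rule continuous_on_cases_le) (use cf eq in \<open>auto intro!: continuous_intros\<close>)
  then show "continuous_on UNIV (\<lambda>x. if x \<ge> s then f x else g x)" by simp
  show "((\<lambda>x. if x \<ge> s then f x else g x) has_real_derivative (if x \<ge> s then f' x else g' x)) (at x)"
    if "x \<notin> {s}" for x
  proof (cases "x > s")
    case True
    have "((\<lambda>x. if x \<ge> s then f x else g x) has_real_derivative f' x) (at x)"
      by (rule has_field_derivative_transform_within_open[OF f, of "{s<..}"]) (use True in auto)
    then show ?thesis using True by simp
  next
    case False
    have "((\<lambda>x. if x \<ge> s then f x else g x) has_real_derivative g' x) (at x)"
      by (rule has_field_derivative_transform_within_open[OF g, of "{..<s}"]) (use False that in auto)
    then show ?thesis using False that by simp
  qed
  show "locally_integrable (\<lambda>x. if x \<ge> s then f' x else g' x)"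
    unfolding locally_integrable_def
  proof (intro allI impI)
    fix K :: "real set" assume "compact K"
    then have int: "set_integrable lborel K f'" "set_integrable lborel K g'"
      using cont by (auto dest!: locally_integrable_continuous simp: locally_integrable_def)
    then have "integrable lborel (\<lambda>x. indicator {s..} x *\<^sub>R (indicator K x *\<^sub>R f' x)
                 + indicator {..<s} x *\<^sub>R (indicator K x *\<^sub>R g' x))"
      by (intro Bochner_Integration.integrable_add
            integrable_mult_indicator[OF _ int(1)[unfolded set_integrable_def]]
            integrable_mult_indicator[OF _ int(2)[unfolded set_integrable_def]]) auto
    also have "(\<lambda>x. indicator {s..} x *\<^sub>R (indicator K x *\<^sub>R f' x)
                 + indicator {..<s} x *\<^sub>R (indicator K x *\<^sub>R g' x))
             = (\<lambda>x. indicator K x *\<^sub>R (if x \<ge> s then f' x else g' x))"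
      by (auto simp: indicator_def)
    finally show "set_integrable lborel K (\<lambda>x. if x \<ge> s then f' x else g' x)"
      by (simp add: set_integrable_def)
  qed
qed simp

subsection \<open>The profile of the travelling wave\<close>

definition wave_x :: "real \<Rightarrow> real \<Rightarrow> real \<Rightarrow> real" where
  "wave_x c t x =
     (if x \<ge> c * t then c / 6 * exp (c * t - x)
      else - (c / 2) * exp (x - c * t) + 2 * c / 3 * exp (2 * x - 2 * c * t))"

definition wave_xx :: "real \<Rightarrow> real \<Rightarrow> real \<Rightarrow> real" where
  "wave_xx c t x =
     (if x \<ge> c * t then - (c / 6) * exp (c * t - x)
      else - (c / 2) * exp (x - c * t) + 4 * c / 3 * exp (2 * x - 2 * c * t))"

text \<open>Both branches are \<open>c^2/4\<close> times the exponential of \<open>-2\<close> times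
  the distance to the crest. The branches are kept apart so that \<open>has_weak_deriv_glue\<close>
  applies.\<close>

definition flux :: "real \<Rightarrow> real \<Rightarrow> real \<Rightarrow> real" where
  "flux c t x =
     (if x \<ge> c * t then c\<^sup>2 / 4 * exp (2 * c * t - 2 * x) else c\<^sup>2 / 4 * exp (2 * x - 2 * c * t))"

definition flux_x :: "real \<Rightarrow> real \<Rightarrow> real \<Rightarrow> real" where
  "flux_x c t x =
     (if x \<ge> c * t then - (c\<^sup>2 / 2) * exp (2 * c * t - 2 * x) else c\<^sup>2 / 2 * exp (2 * x - 2 * c * t))"

text \<open>The profile of \<open>u - u_xx\<close> in the frame moving with the wave, where it does
  not depend on time.\<close>

definition momentum :: "real \<Rightarrow> real \<Rightarrow> real" where
  "momentum c y = (if y \<ge> 0 then 0 else - c * exp (2 * y))"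

text \<open>Both branches equal \<open>-c/6\<close> at the crest.\<close>

lemma has_weak_deriv_wave: "has_weak_deriv (travelling_wave c t) (wave_x c t)"
  unfolding travelling_wave_def[abs_def] wave_x_def[abs_def]
  by (rule has_weak_deriv_glue) (auto intro!: derivative_eq_intros continuous_intros simp: field_simps)

text \<open>Both branches of \<open>wave_x\<close> equal \<open>c/6\<close> at the crest, so the
  second derivative has a jump there but no Dirac mass.\<close>

lemma has_weak_deriv_wave_x: "has_weak_deriv (wave_x c t) (wave_xx c t)"
  unfolding wave_x_def[abs_def] wave_xx_def[abs_def]
  by (rule has_weak_deriv_glue) (auto intro!: derivative_eq_intros continuous_intros simp: field_simps)

lemma has_weak_derivs2_wave: "has_weak_derivs2 (travelling_wave c t) (wave_x c t) (wave_xx c t)"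
  by (simp add: has_weak_derivs2_def has_weak_deriv_wave has_weak_deriv_wave_x)

lemma has_weak_deriv_flux: "has_weak_deriv (flux c t) (flux_x c t)"
  unfolding flux_def[abs_def] flux_x_def[abs_def]
  by (rule has_weak_deriv_glue) (auto intro!: derivative_eq_intros continuous_intros simp: field_simps)

lemma wave_minus_wave_xx: "travelling_wave c t x - wave_xx c t x = momentum c (x - c * t)"
  by (simp add: travelling_wave_def wave_xx_def momentum_def algebra_simps)

text \<open>The operator \<open>2 - d/dx\<close> annihilates the term in \<open>exp(2x)\<close>
  behind the crest. What remains on either side is \<open>-c/2\<close> times an exponential decaying
  away from the crest.\<close>

lemma flux_eq: "(2 * travelling_wave c t x - wave_x c t x)\<^sup>2 = flux c t x"
proof (cases "x \<ge> c * t")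
  case True
  then have *: "2 * travelling_wave c t x - wave_x c t x = - (c / 2) * exp (c * t - x)"
    by (simp add: travelling_wave_def wave_x_def algebra_simps)
  show ?thesis
    unfolding * using True
    by (simp add: flux_def power_mult_distrib power_divide exp_double[symmetric] right_diff_distrib mult.assoc)
next
  case False
  then have *: "2 * travelling_wave c t x - wave_x c t x = - (c / 2) * exp (x - c * t)"
    by (simp add: travelling_wave_def wave_x_def algebra_simps)
  show ?thesis
    unfolding * using False
    by (simp add: flux_def power_mult_distrib power_divide exp_double[symmetric] right_diff_distrib mult.assoc)
qed

text \<open>Ahead of the crest \<open>flux_x\<close> is \<open>-2 flux\<close> and the sum cancels;
  behind it \<open>flux_x\<close> is \<open>2 flux\<close> and the sum is
  \<open>4 flux\<close>.\<close>

lemma two_flux_plus_flux_x: "2 * flux c t x + flux_x c t x = - c * momentum c (x - c * t)"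
  by (simp add: flux_def flux_x_def momentum_def power2_eq_square algebra_simps)

text \<open>The support is a half-line, so integrability comes from exponential decay:
  \<open>exp(-2x)\<close> is integrated over the positive half-line and the result is
  reflected.\<close>

lemma integrable_momentum: "integrable lborel (momentum c)"
proof -
  have "(\<integral>\<^sup>+x. ennreal (exp (- 2 * x)) * indicator {0..} x \<partial>lborel) = ennreal (0 - (- exp (- 2 * 0) / 2))"
  proof (rule nn_integral_FTC_atLeast)
    have "filterlim (\<lambda>x::real. - 2 * x) at_bot at_top"
      by (rule filterlim_tendsto_neg_mult_at_bot[OF tendsto_const _ filterlim_ident]) simp
    then have "((\<lambda>x::real. - exp (- 2 * x) / 2) \<longlongrightarrow> - 0 / 2) at_top"
      by (intro tendsto_intros filterlim_compose[OF exp_at_bot]) auto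
    then show "((\<lambda>x::real. - exp (- 2 * x) / 2) \<longlongrightarrow> 0) at_top" by simp
  qed (auto intro!: derivative_eq_intros)
  then have "(\<integral>\<^sup>+x. ennreal (exp (- 2 * x)) * indicator {0..} x \<partial>lborel) < \<infinity>"
    by (simp only: ennreal_less_top infinity_ennreal_def)
  then have "(\<integral>\<^sup>+x. ennreal (exp (- 2 * x) * indicator {0..} x) \<partial>lborel) < \<infinity>"
    by (simp add: ennreal_mult'' ennreal_indicator)
  then have "integrable lborel (\<lambda>x::real. exp (- 2 * x) * indicator {0..} x)"
    by (intro integrableI_nonneg) auto
  from lborel_integrable_real_affine[OF this, of "-1" 0]
  have *: "integrable lborel (\<lambda>x::real. exp (2 * x) * indicator {0..} (- x))" by simp
  \<comment> \<open>The reflected half-line contains \<open>0\<close>, where \<open>momentum\<close>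
    is zero; the indicator removes that point.\<close>
  have "integrable lborel (\<lambda>x. indicator {..<0} x *\<^sub>R (- c * (exp (2 * x) * indicator {0..} (- x))))"
    by (rule integrable_mult_indicator) (use * in simp_all)
  also have "(\<lambda>x. indicator {..<0} x *\<^sub>R (- c * (exp (2 * x) * indicator {0..} (- x)))) = momentum c"
    by (auto simp: momentum_def indicator_def)
  finally show ?thesis .
qed

subsection \<open>The time derivative of the momentum pairing\<close>

text \<open>Dominated convergence for a real parameter, by reduction to sequences, with a multiple
  of \<bar>k\<bar> dominating.\<close>

lemma tendsto_kernel_integral:
  fixes k :: "real \<Rightarrow> real" and F :: "real \<Rightarrow> real \<Rightarrow> real"
  assumes k: "integrable lborel k"
    and F: "\<And>s. s \<in> S \<Longrightarrow> F s \<in> borel_measurable borel"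
    and lim: "\<And>y. ((\<lambda>s. F s y) \<longlongrightarrow> L y) (at t within S)"
    and bound: "\<forall>\<^sub>F s in at t within S. \<forall>y. \<bar>F s y\<bar> \<le> B"
  shows "((\<lambda>s. LBINT y. k y * F s y) \<longlongrightarrow> (LBINT y. k y * L y)) (at t within S)"
  unfolding tendsto_at_iff_sequentially
proof (intro allI impI)
  fix X assume X: "\<forall>i. X i \<in> S - {t}" "X \<longlonglongrightarrow> t"
  have filt: "filterlim X (at t within S) sequentially"
    unfolding filterlim_at using X by auto
  then have "\<forall>\<^sub>F n in sequentially. \<forall>y. \<bar>F (X n) y\<bar> \<le> B"
    using bound by (auto simp: filterlim_iff)
  \<comment> \<open>The bound holds only near \<open>t\<close>, so the first \<open>N\<close> terms
    of the sequence are dropped; this does not change the limit.\<close>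
  then obtain N where N: "\<And>n y. \<bar>F (X (n + N)) y\<bar> \<le> B"
    by (auto simp: eventually_sequentially) (metis le_add2)
  have limX: "(\<lambda>n. F (X (n + N)) y) \<longlonglongrightarrow> L y" for y
    by (rule LIMSEQ_ignore_initial_segment[OF filterlim_compose[OF lim filt]])
  have meas: "F (X (n + N)) \<in> borel_measurable borel" for n
    using X F by auto
  have "(\<lambda>n. LBINT y. k y * F (X (n + N)) y) \<longlonglongrightarrow> (LBINT y. k y * L y)"
  proof (rule integral_dominated_convergence[where w = "\<lambda>y. \<bar>k y\<bar> * B"])
    have "L \<in> borel_measurable borel"
      using meas limX by (rule borel_measurable_LIMSEQ_real[rotated])
    then show "(\<lambda>y. k y * L y) \<in> borel_measurable lborel"
      using k by simp
    show "(\<lambda>y. k y * F (X (n + N)) y) \<in> borel_measurable lborel" for n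
      using k meas[of n] by simp
    show "integrable lborel (\<lambda>y. \<bar>k y\<bar> * B)" using k by simp
    show "AE y in lborel. (\<lambda>n. k y * F (X (n + N)) y) \<longlonglongrightarrow> k y * L y"
      by (intro AE_I2 tendsto_intros limX)
    show "AE y in lborel. norm (k y * F (X (n + N)) y) \<le> \<bar>k y\<bar> * B" for n
      using N by (auto simp: abs_mult intro!: mult_left_mono)
  qed
  then show "((\<lambda>s. LBINT y. k y * F s y) \<circ> X) \<longlonglongrightarrow> (LBINT y. k y * L y)"
    unfolding o_def by (rule LIMSEQ_offset)
qed

text \<open>Uniformity makes \<open>f s\<close> close to \<open>l\<close> wherever it is evaluated,
  so continuity of \<open>l\<close> handles the moving point. It serves for arguments such as
  \<open>y + c * s\<close>, which move with the time \<open>s\<close>.\<close>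

lemma uniform_limit_compose_tendsto:
  fixes f :: "'i \<Rightarrow> real \<Rightarrow> real"
  assumes f: "uniform_limit UNIV f l F" and l: "isCont l z" and g: "(g \<longlongrightarrow> z) F"
  shows "((\<lambda>s. f s (g s)) \<longlongrightarrow> l z) F"
proof -
  have "((\<lambda>s. f s (g s) - l (g s)) \<longlongrightarrow> 0) F"
    unfolding tendsto_iff
  proof (intro allI impI)
    fix e :: real assume "e > 0"
    from uniform_limitD[OF f this] show "\<forall>\<^sub>F s in F. dist (f s (g s) - l (g s)) 0 < e"
      by eventually_elim (auto simp: dist_real_def)
  qed
  from tendsto_add[OF this isCont_tendsto_compose[OF l g]] show ?thesis by simp
qed

lemma uniform_limit_eventually_bounded:
  fixes f :: "'i \<Rightarrow> real \<Rightarrow> real"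
  assumes f: "uniform_limit UNIV f l F" and l: "\<And>x. \<bar>l x\<bar> \<le> B"
  shows "\<forall>\<^sub>F s in F. \<forall>x. \<bar>f s x\<bar> \<le> B + 1"
  using uniform_limitD[OF f zero_less_one]
proof eventually_elim
  case (elim s)
  show ?case
  proof
    fix x show "\<bar>f s x\<bar> \<le> B + 1"
      using bspec[OF elim, of x] l[of x] by (simp add: dist_real_def)
  qed
qed

text \<open>The last claim is not part of the definition. It holds because the
  \<open>x\<close>-derivatives of the difference quotients converge uniformly and hence are
  eventually bounded, so \<open>deriv (\<phi> s)\<close> differs from
  \<open>deriv (\<phi> t)\<close> by at most a constant times \<bar>s - t\<bar>.\<close>

lemma C1_testD:
  assumes "C1_test T \<phi> \<phi>t" "t \<in> {0..T}"
  shows "\<phi> t \<in> test_functions" "\<phi>t t \<in> test_functions"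
    and "uniform_limit UNIV (\<lambda>s x. (\<phi> s x - \<phi> t x) / (s - t)) (\<phi>t t) (at t within {0..T})"
    and "uniform_limit UNIV \<phi>t (\<phi>t t) (at t within {0..T})"
    and "uniform_limit UNIV (\<lambda>s. deriv (\<phi> s)) (deriv (\<phi> t)) (at t within {0..T})"
proof -
  have q: "test_tendsto (\<lambda>s x. (\<phi> s x - \<phi> t x) / (s - t)) (\<phi>t t) (at t within {0..T})"
    and t: "test_tendsto \<phi>t (\<phi>t t) (at t within {0..T})"
    using assms by (auto simp: C1_test_def)
  have test: "\<phi> s \<in> test_functions" if "s \<in> {0..T}" for s
    using assms(1) that by (auto simp: C1_test_def)
  show "\<phi> t \<in> test_functions" using assms(2) by (rule test)
  show test': "\<phi>t t \<in> test_functions" using t by (simp add: test_tendsto_def)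
  have unif: "\<And>k. uniform_limit UNIV (\<lambda>i. (deriv ^^ k) (\<lambda>x. (\<phi> i x - \<phi> t x) / (i - t)))
                    ((deriv ^^ k) (\<phi>t t)) (at t within {0..T})"
    and "\<And>k. uniform_limit UNIV (\<lambda>i. (deriv ^^ k) (\<phi>t i)) ((deriv ^^ k) (\<phi>t t)) (at t within {0..T})"
    using q t by (auto simp: test_tendsto_def)
  from unif[of 0] this(2)[of 0]
  show "uniform_limit UNIV (\<lambda>s x. (\<phi> s x - \<phi> t x) / (s - t)) (\<phi>t t) (at t within {0..T})"
    "uniform_limit UNIV \<phi>t (\<phi>t t) (at t within {0..T})" by simp_all
  obtain B where B: "B > 0" "\<And>x. \<bar>deriv (\<phi>t t) x\<bar> \<le> B"
    using test_function_bounded[OF deriv_test_function[OF test']] by metis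
  have bd: "\<forall>\<^sub>F s in at t within {0..T}. \<forall>x. \<bar>deriv (\<lambda>x. (\<phi> s x - \<phi> t x) / (s - t)) x\<bar> \<le> B + 1"
    using uniform_limit_eventually_bounded[OF unif[of 1]] B(2) by simp
  have ev: "\<forall>\<^sub>F s in at t within {0..T}. s \<in> {0..T} \<and> s \<noteq> t"
    by (auto simp: eventually_at_filter)
  show "uniform_limit UNIV (\<lambda>s. deriv (\<phi> s)) (deriv (\<phi> t)) (at t within {0..T})"
  proof (rule uniform_limitI)
    fix e :: real assume "e > 0"
    have "((\<lambda>s. (B + 1) * \<bar>s - t\<bar>) \<longlongrightarrow> (B + 1) * \<bar>t - t\<bar>) (at t within {0..T})"
      by (intro tendsto_intros)
    then have "\<forall>\<^sub>F s in at t within {0..T}. (B + 1) * \<bar>s - t\<bar> < e"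
      using \<open>e > 0\<close> by (intro order_tendstoD(2)) auto
    with bd ev show "\<forall>\<^sub>F s in at t within {0..T}. \<forall>x\<in>UNIV. dist (deriv (\<phi> s) x) (deriv (\<phi> t) x) < e"
    proof eventually_elim
      case (elim s)
      show ?case
      proof
        fix x
        have "((\<lambda>x. (\<phi> s x - \<phi> t x) / (s - t)) has_real_derivative
                (deriv (\<phi> s) x - deriv (\<phi> t) x) / (s - t)) (at x)"
          using elim test assms(2)
          by (auto intro!: derivative_eq_intros test_function_DERIV)
        then have "deriv (\<lambda>x. (\<phi> s x - \<phi> t x) / (s - t)) x = (deriv (\<phi> s) x - deriv (\<phi> t) x) / (s - t)"
          by (rule DERIV_imp_deriv)
        with elim have "\<bar>deriv (\<phi> s) x - deriv (\<phi> t) x\<bar> / \<bar>s - t\<bar> \<le> B + 1"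
          by (metis abs_divide)
        then have "\<bar>deriv (\<phi> s) x - deriv (\<phi> t) x\<bar> \<le> (B + 1) * \<bar>s - t\<bar>"
          using elim by (simp add: divide_le_eq)
        then show "dist (deriv (\<phi> s) x) (deriv (\<phi> t) x) < e"
          using elim by (simp add: dist_real_def)
      qed
    qed
  qed
qed

section \<open>Pairing a fixed integrable kernel with translated test functions\<close>

lemma test_function_shift_measurable:
  "f \<in> test_functions \<Longrightarrow> (\<lambda>y. f (y + a)) \<in> borel_measurable borel"
  using test_function_measurable by measurable

lemma test_function_isCont: "f \<in> test_functions \<Longrightarrow> isCont f x"
  by (rule DERIV_isCont[OF test_function_DERIV])

lemma integrable_kernel_mult_shifted_test:
  assumes k: "integrable lborel k" and f: "f \<in> test_functions"
  shows "integrable lborel (\<lambda>y. k y * f (y + a))"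
proof -
  obtain B where B: "B > 0" "\<And>x. \<bar>f x\<bar> \<le> B" using test_function_bounded[OF f] by metis
  have "integrable lborel (\<lambda>y. B * \<bar>k y\<bar>)" using k by simp
  then show ?thesis
  proof (rule Bochner_Integration.integrable_bound)
    show "(\<lambda>y. k y * f (y + a)) \<in> borel_measurable lborel"
      using test_function_shift_measurable[OF f, of a] k by simp
    have "\<bar>k y * f (y + a)\<bar> \<le> B * \<bar>k y\<bar>" for y
      using B by (simp add: abs_mult mult.commute[of B] mult_left_mono)
    then show "AE y in lborel. norm (k y * f (y + a)) \<le> norm (B * \<bar>k y\<bar>)"
      using B(1) by (simp add: abs_mult)
  qed
qed

text \<open>Differentiation under the integral along the lines \<open>y + c * s\<close>; the
  integrand on the right is the total time derivative of \<phi> along such a line.\<close>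

lemma C1_test_moving_pairing_deriv:
  assumes C1: "C1_test T \<phi> \<phi>t" and t: "t \<in> {0..T}" and k: "integrable lborel k"
  shows "((\<lambda>s. LBINT y. k y * \<phi> s (y + c * s)) has_real_derivative
           (LBINT y. k y * (\<phi>t t (y + c * t) + c * deriv (\<phi> t) (y + c * t)))) (at t within {0..T})"
  unfolding has_field_derivative_iff
proof (rule Lim_transform_eventually)
  note D = C1_testD[OF C1 t]
  note test = C1_testD(1)[OF C1]
  define Q where "Q s y = (\<phi> s (y + c * s) - \<phi> t (y + c * t)) / (s - t)" for s y
  \<comment> \<open>The first quotient varies time at the moved point and converges by uniformity;
    the second moves only the point and converges by the chain rule.\<close>
  have Q_split: "Q s y = (\<phi> s (y + c * s) - \<phi> t (y + c * s)) / (s - t)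
                       + (\<phi> t (y + c * s) - \<phi> t (y + c * t)) / (s - t)" for s y
    by (simp add: Q_def add_divide_distrib[symmetric])
  obtain B1 where B1: "\<And>x. \<bar>\<phi>t t x\<bar> \<le> B1" using test_function_bounded[OF D(2)] by metis
  obtain B2 where B2: "B2 > 0" "\<And>x. \<bar>deriv (\<phi> t) x\<bar> \<le> B2"
    using test_function_bounded[OF deriv_test_function[OF D(1)]] by metis
  show "((\<lambda>s. LBINT y. k y * Q s y) \<longlongrightarrow>
          (LBINT y. k y * (\<phi>t t (y + c * t) + c * deriv (\<phi> t) (y + c * t)))) (at t within {0..T})"
  \<comment> \<open>\<open>B1 + 1\<close> bounds the time quotient near \<open>t\<close>;
    \<open>B2 * \<bar>c\<bar>\<close> bounds the space quotient by the mean value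
    inequality.\<close>
  proof (rule tendsto_kernel_integral[OF k, where B = "B1 + 1 + B2 * \<bar>c\<bar>"])
    show "Q s \<in> borel_measurable borel" if "s \<in> {0..T}" for s
      unfolding Q_def
      using test_function_shift_measurable[OF test[OF that]] test_function_shift_measurable[OF D(1)]
      by (intro borel_measurable_divide borel_measurable_diff) auto
    show "((\<lambda>s. Q s y) \<longlongrightarrow> \<phi>t t (y + c * t) + c * deriv (\<phi> t) (y + c * t)) (at t within {0..T})" for y
      unfolding Q_split
    proof (rule tendsto_add)
      show "((\<lambda>s. (\<phi> s (y + c * s) - \<phi> t (y + c * s)) / (s - t)) \<longlongrightarrow> \<phi>t t (y + c * t)) (at t within {0..T})"
        by (rule uniform_limit_compose_tendsto[OF D(3)])
           (auto intro!: tendsto_intros test_function_isCont[OF D(2)])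
      have "((\<lambda>s. \<phi> t (y + c * s)) has_real_derivative deriv (\<phi> t) (y + c * t) * c) (at t within {0..T})"
        by (rule DERIV_chain2[OF test_function_DERIV[OF D(1)]]) (auto intro!: derivative_eq_intros)
      then show "((\<lambda>s. (\<phi> t (y + c * s) - \<phi> t (y + c * t)) / (s - t)) \<longlongrightarrow> c * deriv (\<phi> t) (y + c * t))
                   (at t within {0..T})"
        by (simp add: has_field_derivative_iff mult.commute)
    qed
    have lip: "\<bar>(\<phi> t (y + c * s) - \<phi> t (y + c * t)) / (s - t)\<bar> \<le> B2 * \<bar>c\<bar>" if "s \<noteq> t" for s y
    proof -
      have "norm (\<phi> t (y + c * s) - \<phi> t (y + c * t)) \<le> B2 * norm ((y + c * s) - (y + c * t))"
        by (rule field_differentiable_bound[where S = UNIV and f' = "deriv (\<phi> t)"])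
           (use B2 in \<open>auto intro: test_function_DERIV[OF D(1)]\<close>)
      also have "\<dots> = B2 * \<bar>c\<bar> * \<bar>s - t\<bar>"
        by (simp add: abs_mult[symmetric] right_diff_distrib mult.assoc)
      finally show ?thesis using that by (simp add: abs_divide divide_le_eq)
    qed
    have "\<forall>\<^sub>F s in at t within {0..T}. s \<noteq> t" by (auto simp: eventually_at_filter)
    with uniform_limit_eventually_bounded[OF D(3), of B1, OF B1]
    show "\<forall>\<^sub>F s in at t within {0..T}. \<forall>y. \<bar>Q s y\<bar> \<le> B1 + 1 + B2 * \<bar>c\<bar>"
    proof eventually_elim
      case (elim s)
      show ?case
        unfolding Q_split using elim lip by (intro allI order_trans[OF abs_triangle_ineq] add_mono) auto
    qed
  qed
  have "\<forall>\<^sub>F s in at t within {0..T}. s \<in> {0..T}" by (auto simp: eventually_at_filter)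
  then show "\<forall>\<^sub>F s in at t within {0..T}. (LBINT y. k y * Q s y) =
      ((LBINT y. k y * \<phi> s (y + c * s)) - (LBINT y. k y * \<phi> t (y + c * t))) / (s - t)"
  proof eventually_elim
    case (elim s)
    have "(LBINT y. k y * Q s y) = (LBINT y. (k y * \<phi> s (y + c * s) - k y * \<phi> t (y + c * t)) / (s - t))"
      by (simp add: Q_def right_diff_distrib)
    also have "\<dots> = ((LBINT y. k y * \<phi> s (y + c * s)) - (LBINT y. k y * \<phi> t (y + c * t))) / (s - t)"
      using integrable_kernel_mult_shifted_test[OF k test[OF elim], of "c * s"]
        integrable_kernel_mult_shifted_test[OF k test[OF t], of "c * t"] by simp
    finally show ?case .
  qed
qed

text \<open>Continuity of the time derivative is what the fundamental theorem of calculus needs to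
  give integrability on \<open>[0, T]\<close>.\<close>

lemma C1_test_moving_pairing_continuous:
  assumes C1: "C1_test T \<phi> \<phi>t" and k: "integrable lborel k"
  shows "continuous_on {0..T}
           (\<lambda>t. LBINT y. k y * (\<phi>t t (y + c * t) + c * deriv (\<phi> t) (y + c * t)))"
  unfolding continuous_on_def
proof
  fix t assume t: "t \<in> {0..T}"
  note D = C1_testD[OF C1]
  obtain B1 where B1: "\<And>x. \<bar>\<phi>t t x\<bar> \<le> B1" using test_function_bounded[OF D(2)[OF t]] by metis
  obtain B2 where B2: "\<And>x. \<bar>deriv (\<phi> t) x\<bar> \<le> B2"
    using test_function_bounded[OF deriv_test_function[OF D(1)[OF t]]] by metis
  show "((\<lambda>t. LBINT y. k y * (\<phi>t t (y + c * t) + c * deriv (\<phi> t) (y + c * t))) \<longlongrightarrow>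
          (LBINT y. k y * (\<phi>t t (y + c * t) + c * deriv (\<phi> t) (y + c * t)))) (at t within {0..T})"
  proof (rule tendsto_kernel_integral[OF k, where B = "B1 + 1 + \<bar>c\<bar> * (B2 + 1)"])
    show "(\<lambda>y. \<phi>t s (y + c * s) + c * deriv (\<phi> s) (y + c * s)) \<in> borel_measurable borel"
      if "s \<in> {0..T}" for s
      using test_function_shift_measurable[OF D(2)[OF that]]
        test_function_shift_measurable[OF deriv_test_function[OF D(1)[OF that]]] by simp
    show "((\<lambda>s. \<phi>t s (y + c * s) + c * deriv (\<phi> s) (y + c * s)) \<longlongrightarrow>
            \<phi>t t (y + c * t) + c * deriv (\<phi> t) (y + c * t)) (at t within {0..T})" for y
      by (intro tendsto_add tendsto_mult tendsto_const
            uniform_limit_compose_tendsto[OF D(4)[OF t]] uniform_limit_compose_tendsto[OF D(5)[OF t]]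
            test_function_isCont D(2)[OF t] deriv_test_function D(1)[OF t] tendsto_ident_at)
    show "\<forall>\<^sub>F s in at t within {0..T}. \<forall>y. \<bar>\<phi>t s (y + c * s) + c * deriv (\<phi> s) (y + c * s)\<bar>
            \<le> B1 + 1 + \<bar>c\<bar> * (B2 + 1)"
      using uniform_limit_eventually_bounded[OF D(4)[OF t] B1]
        uniform_limit_eventually_bounded[OF D(5)[OF t] B2]
    proof eventually_elim
      case (elim s)
      show ?case
        using elim
        by (intro allI order_trans[OF abs_triangle_ineq] add_mono)
           (auto simp: abs_mult intro: mult_left_mono)
    qed
  qed
qed

subsection \<open>The weak formulation\<close>

text \<open>Passing to the moving frame puts all time dependence into the test function and leaves a
  fixed kernel.\<close>

lemma momentum_pairing_shift:
  "(LBINT x. momentum c (x - c * t) * f x) = (LBINT y. momentum c y * f (y + c * t))"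
  using lborel_integral_real_affine[of 1 "\<lambda>x. momentum c (x - c * t) * f x" "c * t"]
  by (simp add: add.commute)

lemma weak_derivs2_pairing:
  assumes "has_weak_derivs2 v v1 v2" "\<psi> \<in> test_functions"
  shows "(LBINT x. v x * deriv (deriv \<psi>) x) = (LBINT x. v2 x * \<psi> x)"
  using assms deriv_test_function[OF assms(2)]
  by (simp add: has_weak_derivs2_def has_weak_deriv_def)

text \<open>The representative \<open>v2\<close> enters linearly, so it suffices that
  \<open>v2\<close> and \<open>wave_xx\<close> have the same pairing with \<psi>: both equal the
  pairing of the wave with the second derivative of \<psi>.\<close>

lemma wave_momentum_pairing:
  assumes v: "has_weak_derivs2 (travelling_wave c t) v1 v2" and \<psi>: "\<psi> \<in> test_functions"
  shows "integrable lborel (\<lambda>x. (travelling_wave c t x - v2 x) * \<psi> x)"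
    and "(LBINT x. (travelling_wave c t x - v2 x) * \<psi> x) = (LBINT y. momentum c y * \<psi> (y + c * t))"
proof -
  have int: "integrable lborel (\<lambda>x. travelling_wave c t x * \<psi> x)" "integrable lborel (\<lambda>x. v2 x * \<psi> x)"
    "integrable lborel (\<lambda>x. wave_xx c t x * \<psi> x)"
    using v has_weak_derivs2_wave[of c t] integrable_mult_test[OF _ \<psi>]
    by (auto simp: has_weak_derivs2_def has_weak_deriv_def)
  then show "integrable lborel (\<lambda>x. (travelling_wave c t x - v2 x) * \<psi> x)"
    by (simp add: left_diff_distrib)
  have "(LBINT x. v2 x * \<psi> x) = (LBINT x. wave_xx c t x * \<psi> x)"
    using weak_derivs2_pairing[OF v \<psi>] weak_derivs2_pairing[OF has_weak_derivs2_wave \<psi>, of c t] by simp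
  then have "(LBINT x. (travelling_wave c t x - v2 x) * \<psi> x)
           = (LBINT x. (travelling_wave c t x - wave_xx c t x) * \<psi> x)"
    using int by (simp add: left_diff_distrib)
  then show "(LBINT x. (travelling_wave c t x - v2 x) * \<psi> x) = (LBINT y. momentum c y * \<psi> (y + c * t))"
    by (simp add: wave_minus_wave_xx momentum_pairing_shift)
qed

text \<open>Here \<open>v1\<close> enters through a square, so it is first replaced by
  \<open>wave_x\<close> almost everywhere. Integration by parts then moves the derivatives onto the
  wave and the flux, where the identities for \<open>momentum\<close> apply.\<close>

lemma wave_weak_integrand:
  assumes v: "has_weak_derivs2 (travelling_wave c t) v1 v2"
    and p: "p \<in> test_functions" and q: "q \<in> test_functions"
  shows "integrable lborel (weak_integrand (travelling_wave c t) v1 p q)"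
    and "(LBINT x. weak_integrand (travelling_wave c t) v1 p q x)
       = (LBINT y. momentum c y * (q (y + c * t) + c * deriv p (y + c * t)))"
proof -
  let ?u = "travelling_wave c t"
  \<comment> \<open>Written as a combination of separately integrable products, so that the integral
    can be split.\<close>
  let ?I = "\<lambda>x. ?u x * q x - ?u x * deriv (deriv q) x
                - (2 * (flux c t x * deriv p x) - flux c t x * deriv (deriv p) x)"
  have loc: "locally_integrable ?u" "locally_integrable v1" "locally_integrable (flux c t)"
    "locally_integrable (flux_x c t)" "locally_integrable (wave_xx c t)"
    using v has_weak_deriv_flux has_weak_deriv_wave_x
    by (auto simp: has_weak_derivs2_def has_weak_deriv_def)
  note test = p q deriv_test_function[OF p] deriv_test_function[OF q]
    deriv_test_function[OF deriv_test_function[OF p]] deriv_test_function[OF deriv_test_function[OF q]]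
  note int = test[THEN integrable_mult_test[OF loc(1)]] test[THEN integrable_mult_test[OF loc(3)]]
    test[THEN integrable_mult_test[OF loc(4)]] test[THEN integrable_mult_test[OF loc(5)]]
  have "AE x in lborel. v1 x = wave_x c t x"
    using v has_weak_deriv_wave has_weak_deriv_unique by (auto simp: has_weak_derivs2_def)
  then have ae: "AE x in lborel. weak_integrand ?u v1 p q x = ?I x"
  proof eventually_elim
    case (elim x)
    show ?case
      by (simp only: weak_integrand_def elim flux_eq) (simp add: algebra_simps)
  qed
  have meas: "weak_integrand ?u v1 p q \<in> borel_measurable lborel"
    unfolding weak_integrand_def[abs_def]
    using loc(1,2)[THEN locally_integrable_borel] test[THEN test_function_measurable] by simp
  have intI: "integrable lborel ?I" using int by simp
  show "integrable lborel (weak_integrand ?u v1 p q)"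
    using integrable_cong_AE[OF meas borel_measurable_integrable[OF intI] ae] intI by simp
  have "(LBINT x. weak_integrand ?u v1 p q x) = (LBINT x. ?I x)"
    by (rule integral_cong_AE[OF meas borel_measurable_integrable[OF intI] ae])
  also have "\<dots> = (LBINT x. ?u x * q x) - (LBINT x. ?u x * deriv (deriv q) x)
      - (2 * (LBINT x. flux c t x * deriv p x) - (LBINT x. flux c t x * deriv (deriv p) x))"
    using int by simp
  \<comment> \<open>Two integrations by parts for \<open>q\<close> keep the sign; the single one for
    \<open>p\<close>, with test function \<open>deriv p\<close>, reverses it.\<close>
  also have "\<dots> = (LBINT x. ?u x * q x) - (LBINT x. wave_xx c t x * q x)
      - (2 * (LBINT x. flux c t x * deriv p x) + (LBINT x. flux_x c t x * deriv p x))"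
    using has_weak_deriv_flux[of c t] test weak_derivs2_pairing[OF has_weak_derivs2_wave q, of c t]
    by (simp add: has_weak_deriv_def)
  also have "\<dots> = (LBINT x. ?u x * q x - wave_xx c t x * q x
                     - (2 * (flux c t x * deriv p x) + flux_x c t x * deriv p x))"
    using int by simp
  also have "\<dots> = (LBINT x. (?u x - wave_xx c t x) * q x - (2 * flux c t x + flux_x c t x) * deriv p x)"
    by (simp only: left_diff_distrib distrib_right mult.assoc)
  also have "\<dots> = (LBINT x. momentum c (x - c * t) * (q x + c * deriv p x))"
    unfolding wave_minus_wave_xx two_flux_plus_flux_x by (simp add: distrib_left mult.assoc mult.left_commute)
  finally show "(LBINT x. weak_integrand ?u v1 p q x)
       = (LBINT y. momentum c y * (q (y + c * t) + c * deriv p (y + c * t)))"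
    by (simp add: momentum_pairing_shift)
qed

theorem mainTheorem5:
  fixes c :: real
  assumes "c > 0"
  shows "weak_solution (travelling_wave c) (travelling_wave c 0)"
  unfolding weak_solution_def
proof (intro conjI allI impI)
  show "\<exists>v1 v2. has_weak_derivs2 (travelling_wave c t) v1 v2" for t
    using has_weak_derivs2_wave by blast
  then show "\<exists>v1 v2. has_weak_derivs2 (travelling_wave c 0) v1 v2" .
  fix ux uxx u0x u0xx T \<phi> \<phi>t
  assume weak: "(\<forall>t\<ge>0. has_weak_derivs2 (travelling_wave c t) (ux t) (uxx t)) \<and>
      has_weak_derivs2 (travelling_wave c 0) u0x u0xx"
    and "(0::real) < T" and C1: "C1_test T \<phi> \<phi>t"
  \<comment> \<open>\<open>G\<close> takes the two boundary values on the right of the weak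
    identity, and \<open>H\<close> is its time derivative.\<close>
  define G where "G t = (LBINT y. momentum c y * \<phi> t (y + c * t))" for t
  define H where "H t = (LBINT y. momentum c y * (\<phi>t t (y + c * t) + c * deriv (\<phi> t) (y + c * t)))" for t
  have inner: "integrable lborel (weak_integrand (travelling_wave c t) (ux t) (\<phi> t) (\<phi>t t))"
    "(LBINT x. weak_integrand (travelling_wave c t) (ux t) (\<phi> t) (\<phi>t t) x) = H t" if "t \<in> {0..T}" for t
    using wave_weak_integrand[of c t "ux t" "uxx t" "\<phi> t" "\<phi>t t"] C1_testD(1,2)[OF C1 that] weak that
    by (auto simp: H_def)
  show "\<forall>t\<in>{0..T}. integrable lborel (weak_integrand (travelling_wave c t) (ux t) (\<phi> t) (\<phi>t t))"
    using inner by blast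
  have FTC: "has_bochner_integral lborel (\<lambda>t. indicator {0..T} t *\<^sub>R H t) (G T - G 0)"
  proof (rule has_bochner_integral_FTC_Icc)
    show "(G has_vector_derivative H t) (at t within {0..T})" if "0 \<le> t" "t \<le> T" for t
      using C1_test_moving_pairing_deriv[OF C1 _ integrable_momentum] that
      unfolding G_def[abs_def] H_def has_real_derivative_iff_has_vector_derivative by simp
    show "continuous_on {0..T} H"
      unfolding H_def[abs_def] by (rule C1_test_moving_pairing_continuous[OF C1 integrable_momentum])
  qed (use \<open>0 < T\<close> in simp)
  \<comment> \<open>The inner integral is known to be \<open>H t\<close> only on
    \<open>[0, T]\<close>; the indicator hides the times at which \<phi> is unconstrained.\<close>
  have indicator_H: "(\<lambda>t. indicator {0..T} t *\<^sub>R
      (LBINT x. weak_integrand (travelling_wave c t) (ux t) (\<phi> t) (\<phi>t t) x)) =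
      (\<lambda>t. indicator {0..T} t *\<^sub>R H t)"
    using inner(2) by (auto simp: indicator_def)
  show "set_integrable lborel {0..T}
          (\<lambda>t. LBINT x. weak_integrand (travelling_wave c t) (ux t) (\<phi> t) (\<phi>t t) x)"
    unfolding set_integrable_def indicator_H using FTC by (rule integrable.intros)
  have final: "integrable lborel (\<lambda>x. (travelling_wave c T x - uxx T x) * \<phi> T x)"
    "(LBINT x. (travelling_wave c T x - uxx T x) * \<phi> T x) = G T"
    using wave_momentum_pairing[of c T "ux T" "uxx T" "\<phi> T"] C1_testD(1)[OF C1, of T] weak \<open>0 < T\<close>
    by (auto simp: G_def)
  have initial: "integrable lborel (\<lambda>x. (travelling_wave c 0 x - u0xx x) * \<phi> 0 x)"
    "(LBINT x. (travelling_wave c 0 x - u0xx x) * \<phi> 0 x) = G 0"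
    using wave_momentum_pairing[of c 0 u0x u0xx "\<phi> 0"] C1_testD(1)[OF C1, of 0] weak \<open>0 < T\<close>
    by (auto simp: G_def)
  show "integrable lborel (\<lambda>x. (travelling_wave c T x - uxx T x) * \<phi> T x)" by (rule final(1))
  show "integrable lborel (\<lambda>x. (travelling_wave c 0 x - u0xx x) * \<phi> 0 x)" by (rule initial(1))
  show "(LBINT t:{0..T}. (LBINT x. weak_integrand (travelling_wave c t) (ux t) (\<phi> t) (\<phi>t t) x)) =
      (LBINT x. (travelling_wave c T x - uxx T x) * \<phi> T x)
      - (LBINT x. (travelling_wave c 0 x - u0xx x) * \<phi> 0 x)"
    unfolding set_lebesgue_integral_def indicator_H final(2) initial(2)
    using FTC by (rule has_bochner_integral_integral_eq)
qed

end
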